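(* Let $A$ be a finite set with $k$ elements, partitioned into nonempty disjoint parts $A=A_1\cup\dots\cup A_d$. Then the complex $K(A;A_1,\dots,A_d)$ of connected concordant graphs is acyclic in all dimensions not equal to $k-2$, i.e., $H_i(K(A;A_1,\dots,A_d);\mathbb{Z})=0$ for all $i\neq k-2$.
   Context: A graph with vertex set $A$ is concordant with the partition $A=A_1\cup\dots\cup A_d$ if the two endpoints of each of its edges lie in different parts $A_i$. Let $\Delta(A;A_1,\dots,A_d)$ be the simplex whose vertices correspond to the two-element subsets $\{a,b\}\subset A$ with $a,b$ in different parts (so it has $\sum_{i<j}|A_i||A_j|$ vertices); a face is identified with the concordant graph whose edges are the corresponding subsets. A graph is connected if any two points of $A$ can be joined by a chain of its edges. The faces corresponding to non-connected graphs form a subcomplex, and $K(A;A_1,\dots,A_d)$ is the quotient of the (augmented, the empty face having dimension $-1$) simplicial chain complex of $\Delta(A;A_1,\dots,A_d)$ by the chains of this subcomplex. *)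

theory Defs
  imports
    "HOL-Algebra.Free_Abelian_Groups"
    "HOL-Algebra.Elementary_Groups"
    "HOL-Library.Disjoint_Sets"
begin

section \<open>Quotients of simplicial chain complexes\<close>

text \<open>
  An abstract simplicial complex is given by its set of faces \<open>K\<close>; the empty face belongs to it and
  has dimension \<open>-1\<close>, so that chain groups are indexed by integers.
\<close>

definition simplex_chain_group :: "'e set set \<Rightarrow> int \<Rightarrow> ('e set \<Rightarrow>\<^sub>0 int) monoid" where
  "simplex_chain_group K i =
     free_Abelian_group {F \<in> K. finite F \<and> int (card F) - 1 = i}"

text \<open>
  Faces are oriented by a linear order \<open>r\<close> on the vertices: if \<open>v\<^sub>0 < \<dots> < v\<^sub>n\<close> are the vertices of \<open>F\<close>,
  then the coefficient of \<open>F - {v\<^sub>j}\<close> in the boundary of \<open>F\<close> is \<open>(-1)^j\<close>. The boundary of a vertex is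
  the empty face (augmentation), and the boundary of the empty face is \<open>0\<close>.
\<close>

definition simplex_boundary :: "'e rel \<Rightarrow> ('e set \<Rightarrow>\<^sub>0 int) \<Rightarrow> ('e set \<Rightarrow>\<^sub>0 int)" where
  "simplex_boundary r =
     frag_extend (\<lambda>F. \<Sum>v\<in>F. frag_cmul ((-1) ^ card {u \<in> F. u \<noteq> v \<and> (u, v) \<in> r}) (frag_of (F - {v})))"

definition quotient_chain_group ::
    "'e set set \<Rightarrow> 'e set set \<Rightarrow> int \<Rightarrow> ('e set \<Rightarrow>\<^sub>0 int) set monoid" where
  "quotient_chain_group K L i = simplex_chain_group K i Mod carrier (simplex_chain_group L i)"

text \<open>
  The map induced by the boundary on cosets. For a subcomplex \<open>L\<close> of \<open>K\<close> all elements of a coset \<open>X\<close>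
  have boundaries in one and the same coset, which \<open>the_elem\<close> extracts.
\<close>

definition quotient_boundary ::
    "'e rel \<Rightarrow> 'e set set \<Rightarrow> 'e set set \<Rightarrow> int \<Rightarrow> ('e set \<Rightarrow>\<^sub>0 int) set \<Rightarrow> ('e set \<Rightarrow>\<^sub>0 int) set" where
  "quotient_boundary r K L i X =
     the_elem ((\<lambda>c. carrier (simplex_chain_group L (i - 1))
                    #>\<^bsub>simplex_chain_group K (i - 1)\<^esub> simplex_boundary r c) ` X)"

definition quotient_homology_group ::
    "'e rel \<Rightarrow> 'e set set \<Rightarrow> 'e set set \<Rightarrow> int \<Rightarrow> ('e set \<Rightarrow>\<^sub>0 int) set set monoid" where
  "quotient_homology_group r K L i =
     subgroup_generated (quotient_chain_group K L i)
       (kernel (quotient_chain_group K L i) (quotient_chain_group K L (i - 1))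
               (quotient_boundary r K L i))
     Mod (quotient_boundary r K L (i + 1) ` carrier (quotient_chain_group K L (i + 1)))"

section \<open>Concordant graphs\<close>

text \<open>Graphs on a vertex set \<open>A\<close> are identified with their sets of edges, an edge being a two-element set.\<close>

definition concordant_edges :: "nat \<Rightarrow> (nat \<Rightarrow> 'a set) \<Rightarrow> 'a set set" where
  "concordant_edges d P =
     {{a, b} | a b i j. i \<in> {1..d} \<and> j \<in> {1..d} \<and> i \<noteq> j \<and> a \<in> P i \<and> b \<in> P j}"

definition connected_graph :: "'a set \<Rightarrow> 'a set set \<Rightarrow> bool" where
  "connected_graph A G \<longleftrightarrow> (\<forall>a\<in>A. \<forall>b\<in>A. (a, b) \<in> {(x, y). {x, y} \<in> G}\<^sup>*)"

definition concordant_simplex :: "nat \<Rightarrow> (nat \<Rightarrow> 'a set) \<Rightarrow> 'a set set set" where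
  "concordant_simplex d P = Pow (concordant_edges d P)"

definition nonconnected_subcomplex :: "'a set \<Rightarrow> nat \<Rightarrow> (nat \<Rightarrow> 'a set) \<Rightarrow> 'a set set set" where
  "nonconnected_subcomplex A d P = {G \<in> concordant_simplex d P. \<not> connected_graph A G}"

definition connected_graph_homology ::
    "'a set rel \<Rightarrow> 'a set \<Rightarrow> nat \<Rightarrow> (nat \<Rightarrow> 'a set) \<Rightarrow> int \<Rightarrow> ('a set set \<Rightarrow>\<^sub>0 int) set set monoid" where
  "connected_graph_homology r A d P i =
     quotient_homology_group r (concordant_simplex d P) (nonconnected_subcomplex A d P) i"

end

theory Submission
  imports Defs
begin

text \<open>
  Deletion and contraction of the smallest edge \<open>e\<close>, applied to arbitrary graphs rather than only to the
  complete multipartite one. Since \<open>e\<close> comes first in every face containing it, writing a chain as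
  \<open>a + e b\<close> with \<open>a\<close>, \<open>b\<close> free of \<open>e\<close> gives the boundary \<open>\<partial>a + b - e \<partial>b\<close>. So if the chain is a relative
  cycle, then \<open>b\<close> is a relative cycle of the graph with \<open>e\<close> contracted. If \<open>e\<close> joins two components, \<open>b\<close> is
  by induction a boundary \<open>\<partial>b'\<close>, and the chain is homologous to \<open>a + b'\<close>, which lives in the graph with \<open>e\<close>
  deleted. If \<open>e\<close> is a loop, \<open>e a\<close> bounds the chain. In dimensions below \<open>k - 2\<close> there are no connected graphs.
\<close>

section \<open>Simplicial chains and cones\<close>

lemma keys_subset_add:
  "Poly_Mapping.keys a \<subseteq> S \<Longrightarrow> Poly_Mapping.keys b \<subseteq> S \<Longrightarrow> Poly_Mapping.keys (a + b) \<subseteq> S"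
  using Poly_Mapping.keys_add[of a b] by blast

lemma keys_subset_diff:
  "Poly_Mapping.keys a \<subseteq> S \<Longrightarrow> Poly_Mapping.keys b \<subseteq> S \<Longrightarrow> Poly_Mapping.keys (a - b) \<subseteq> S"
  using Poly_Mapping.keys_diff[of a b] by blast

lemma keys_frag_extend_subset:
  assumes "Poly_Mapping.keys c \<subseteq> S" and "\<And>x. x \<in> S \<Longrightarrow> Poly_Mapping.keys (f x) \<subseteq> T"
  shows "Poly_Mapping.keys (frag_extend f c) \<subseteq> T"
  using keys_frag_extend[of f c] assms by blast

lemma simplex_boundary_0 [simp]: "simplex_boundary r 0 = 0"
  by (simp add: simplex_boundary_def)

lemma simplex_boundary_add: "simplex_boundary r (a + b) = simplex_boundary r a + simplex_boundary r b"
  by (simp add: simplex_boundary_def frag_extend_add)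

lemma simplex_boundary_diff: "simplex_boundary r (a - b) = simplex_boundary r a - simplex_boundary r b"
  by (simp add: simplex_boundary_def frag_extend_diff)

lemma keys_simplex_boundary:
  "Poly_Mapping.keys (simplex_boundary r c) \<subseteq> {F - {v} | F v. F \<in> Poly_Mapping.keys c \<and> v \<in> F}"
  unfolding simplex_boundary_def
proof (rule keys_frag_extend_subset[OF order_refl])
  fix F assume F: "F \<in> Poly_Mapping.keys c"
  show "Poly_Mapping.keys (\<Sum>v\<in>F. frag_cmul ((-1) ^ card {u \<in> F. u \<noteq> v \<and> (u, v) \<in> r}) (frag_of (F - {v})))
      \<subseteq> {F - {v} | F v. F \<in> Poly_Mapping.keys c \<and> v \<in> F}"
    by (rule order_trans[OF keys_sum]) (use F in \<open>force simp: keys_frag_of\<close>)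
qed

text \<open>Carries no sign, so it is the oriented join with \<open>e\<close> only for faces that
  avoid \<open>e\<close> and lie above it in \<open>r\<close>; it is used with \<open>e\<close> the
  least edge.\<close>

definition cone :: "'e \<Rightarrow> ('e set \<Rightarrow>\<^sub>0 int) \<Rightarrow> ('e set \<Rightarrow>\<^sub>0 int)" where
  "cone e = frag_extend (\<lambda>F. frag_of (insert e F))"

text \<open>The factor \<open>b\<close> in the splitting \<open>a + e b\<close> of a chain;
  \<open>deletion_part\<close> is the summand \<open>a\<close>.\<close>

definition link_part :: "'e \<Rightarrow> ('e set \<Rightarrow>\<^sub>0 int) \<Rightarrow> ('e set \<Rightarrow>\<^sub>0 int)" where
  "link_part e = frag_extend (\<lambda>F. if e \<in> F then frag_of (F - {e}) else 0)"

definition deletion_part :: "'e \<Rightarrow> ('e set \<Rightarrow>\<^sub>0 int) \<Rightarrow> ('e set \<Rightarrow>\<^sub>0 int)" where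
  "deletion_part e = frag_extend (\<lambda>F. if e \<in> F then 0 else frag_of F)"

lemmas cone_add = frag_extend_add[of "\<lambda>F. frag_of (insert e F)" for e, folded cone_def]
lemmas cone_diff = frag_extend_diff[of "\<lambda>F. frag_of (insert e F)" for e, folded cone_def]
lemmas link_part_diff = frag_extend_diff[of "\<lambda>F. if e \<in> F then frag_of (F - {e}) else 0" for e, folded link_part_def]
lemmas deletion_part_diff = frag_extend_diff[of "\<lambda>F. if e \<in> F then 0 else frag_of F" for e, folded deletion_part_def]

lemma keys_cone: "Poly_Mapping.keys (cone e c) \<subseteq> insert e ` Poly_Mapping.keys c"
  unfolding cone_def by (rule keys_frag_extend_subset[OF order_refl]) (auto simp: keys_frag_of)

lemma keys_link_part:
  "Poly_Mapping.keys (link_part e c) \<subseteq> {F - {e} | F. F \<in> Poly_Mapping.keys c \<and> e \<in> F}"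
  unfolding link_part_def by (rule keys_frag_extend_subset[OF order_refl]) (auto simp: keys_frag_of)

lemma keys_deletion_part: "Poly_Mapping.keys (deletion_part e c) \<subseteq> {F \<in> Poly_Mapping.keys c. e \<notin> F}"
  unfolding deletion_part_def by (rule keys_frag_extend_subset[OF order_refl]) (auto simp: keys_frag_of)

lemma deletion_plus_cone_link: "deletion_part e c + cone e (link_part e c) = c"
proof -
  have "Poly_Mapping.keys c \<subseteq> UNIV" by simp
  then show ?thesis
  proof (induction c rule: frag_induction)
    case (one F)
    then show ?case by (auto simp: deletion_part_def cone_def link_part_def insert_absorb)
  next
    case (diff a b)
    have "deletion_part e (a - b) + cone e (link_part e (a - b)) =
        (deletion_part e a + cone e (link_part e a)) - (deletion_part e b + cone e (link_part e b))"
      by (simp add: deletion_part_diff cone_diff link_part_diff)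
    then show ?case using diff by simp
  qed (simp add: deletion_part_def cone_def link_part_def)
qed

lemma link_part_cone:
  "Poly_Mapping.keys c \<subseteq> {F. e \<notin> F} \<Longrightarrow> link_part e (cone e c) = c"
  by (induction c rule: frag_induction)
     (auto simp: cone_def link_part_def frag_extend_diff)

lemma link_part_eq_0: "Poly_Mapping.keys c \<subseteq> {F. e \<notin> F} \<Longrightarrow> link_part e c = 0"
  unfolding link_part_def by (rule frag_extend_eq_0) auto

lemma deletion_part_cone [simp]: "deletion_part e (cone e c) = 0"
  using order_refl[of "Poly_Mapping.keys c"]
  by (induction c rule: frag_induction) (auto simp: cone_def deletion_part_def frag_extend_diff)

lemma deletion_part_id: "Poly_Mapping.keys c \<subseteq> {F. e \<notin> F} \<Longrightarrow> deletion_part e c = c"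
  by (induction c rule: frag_induction) (auto simp: deletion_part_def frag_extend_diff)

text \<open>The vertex \<open>e\<close> stands first, so deleting it has sign \<open>+1\<close>,
  while its presence shifts every other vertex by one place and flips that vertex's sign.\<close>

lemma simplex_boundary_cone:
  assumes "antisym r"
    and "Poly_Mapping.keys c \<subseteq> {F. finite F \<and> e \<notin> F \<and> (\<forall>u\<in>F. (e, u) \<in> r)}"
  shows "simplex_boundary r (cone e c) = c - cone e (simplex_boundary r c)"
  using assms(2)
proof (induction c rule: frag_induction)
  case (one F)
  then have F: "finite F" "e \<notin> F" "\<And>u. u \<in> F \<Longrightarrow> (e, u) \<in> r" by auto
  let ?s = "\<lambda>G v. (-1::int) ^ card {u \<in> G. u \<noteq> v \<and> (u, v) \<in> r}"
  \<comment> \<open>By antisymmetry nothing in \<open>F\<close> precedes \<open>e\<close>.\<close>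
  have "{u \<in> insert e F. u \<noteq> e \<and> (u, e) \<in> r} = {}"
    using F assms(1) by (auto dest: antisymD)
  then have e: "?s (insert e F) e = 1" by (metis card.empty power_0)
  have v: "frag_cmul (?s (insert e F) v) (frag_of (insert e F - {v})) =
      - frag_cmul (?s F v) (frag_of (insert e (F - {v})))" if "v \<in> F" for v
  proof -
    \<comment> \<open>One more predecessor, namely \<open>e\<close>: this is the source of the minus
      sign.\<close>
    have "{u \<in> insert e F. u \<noteq> v \<and> (u, v) \<in> r} = insert e {u \<in> F. u \<noteq> v \<and> (u, v) \<in> r}"
      using that F by auto
    moreover have "insert e F - {v} = insert e (F - {v})" using that F by auto
    ultimately show ?thesis using F by simp
  qed
  have "simplex_boundary r (cone e (frag_of F)) =
      (\<Sum>v\<in>insert e F. frag_cmul (?s (insert e F) v) (frag_of (insert e F - {v})))"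
    by (simp add: simplex_boundary_def cone_def)
  also have "\<dots> = frag_of F + (\<Sum>v\<in>F. - frag_cmul (?s F v) (frag_of (insert e (F - {v}))))"
    unfolding sum.insert[OF F(1,2)] e using F(2) by (intro arg_cong2[where f="(+)"] sum.cong refl v) simp_all
  also have "\<dots> = frag_of F - cone e (simplex_boundary r (frag_of F))"
    using F by (simp add: simplex_boundary_def cone_def frag_extend_sum frag_extend_cmul sum_negf o_def del: minus_frag_cmul)
  finally show ?case .
next
  case (diff a b)
  then show ?case by (simp add: simplex_boundary_diff cone_diff)
qed (simp add: cone_def)

section \<open>The least vertex of a face and the square of the boundary\<close>

lemma linear_order_on_finite_least:
  assumes "linear_order_on U r" and "finite E" and "E \<noteq> {}" and "E \<subseteq> U"
  obtains e where "e \<in> E" and "\<And>u. u \<in> E \<Longrightarrow> (e, u) \<in> r"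
proof -
  from assms(2,3,4) have "\<exists>e\<in>E. \<forall>u\<in>E. (e, u) \<in> r"
  proof (induction E rule: finite_ne_induct)
    case (singleton x)
    then show ?case using assms(1) by (auto simp: order_on_defs refl_on_def)
  next
    case (insert x F)
    then obtain e where e: "e \<in> F" "\<forall>u\<in>F. (e, u) \<in> r" by auto
    have x: "(x, x) \<in> r" "(x, e) \<in> r \<or> (e, x) \<in> r"
      using assms(1) insert e by (auto simp: order_on_defs refl_on_def total_on_def)
    have "trans r" using assms(1) by (simp add: order_on_defs)
    then have "(x, e) \<in> r \<Longrightarrow> \<forall>u\<in>F. (x, u) \<in> r" using e by (meson transD)
    with x e show ?case by auto
  qed
  then show thesis using that by blast
qed

text \<open>A nonempty face is the cone from its least vertex \<open>e\<close> over
  \<open>f = F - {e}\<close>. Applying the cone formula twice gives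
  \<open>\<partial>f - (\<partial>f - e \<partial>\<partial>f)\<close>, and
  \<open>\<partial>\<partial>f = 0\<close> by induction on the size.\<close>

lemma simplex_boundary_boundary_simplex:
  assumes "linear_order_on U r" and "finite F" and "F \<subseteq> U"
  shows "simplex_boundary r (simplex_boundary r (frag_of F)) = 0"
  using assms(2,3)
proof (induction "card F" arbitrary: F)
  case 0
  then show ?case by (simp add: simplex_boundary_def)
next
  case (Suc n)
  then obtain e where e: "e \<in> F" "\<And>u. u \<in> F \<Longrightarrow> (e, u) \<in> r"
    using linear_order_on_finite_least[OF assms(1)]
    by (metis card.empty nat.distinct(1))
  have anti: "antisym r" using assms(1) by (simp add: order_on_defs)
  let ?f = "frag_of (F - {e})"
  have keys: "Poly_Mapping.keys ?f \<subseteq> {F. finite F \<and> e \<notin> F \<and> (\<forall>u\<in>F. (e, u) \<in> r)}"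
    using Suc e by (auto simp: keys_frag_of)
  \<comment> \<open>The faces of \<open>\<partial>f\<close> still avoid \<open>e\<close> and lie
    above it, so the cone formula applies a second time.\<close>
  have "Poly_Mapping.keys (simplex_boundary r ?f) \<subseteq> {F. finite F \<and> e \<notin> F \<and> (\<forall>u\<in>F. (e, u) \<in> r)}"
    using keys_simplex_boundary[of r ?f] keys by (fastforce simp: keys_frag_of)
  note b2 = simplex_boundary_cone[OF anti this]
  have "frag_of F = cone e ?f" using e by (simp add: cone_def insert_absorb)
  moreover have "simplex_boundary r (simplex_boundary r ?f) = 0"
    using Suc.hyps(2) Suc.prems e by (intro Suc.hyps(1)) auto
  ultimately show ?case
    by (simp add: simplex_boundary_cone[OF anti keys] simplex_boundary_diff b2) (simp add: cone_def)
qed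

lemma simplex_boundary_boundary:
  assumes "linear_order_on U r" and "Poly_Mapping.keys c \<subseteq> {F. finite F \<and> F \<subseteq> U}"
  shows "simplex_boundary r (simplex_boundary r c) = 0"
  using assms(2)
  by (induction c rule: frag_induction)
     (auto simp: simplex_boundary_diff simplex_boundary_boundary_simplex[OF assms(1)])

section \<open>Connected components\<close>

text \<open>Taken on the whole type, so that it is an equivalence on \<open>UNIV\<close> whatever
  the edges are; points on no edge form singleton classes.\<close>

definition graph_reach :: "'a set set \<Rightarrow> 'a rel" where
  "graph_reach C = {(x, y). {x, y} \<in> C}\<^sup>*"

text \<open>The vertex set of the graph obtained from \<open>A\<close> by contracting the edges in
  \<open>C\<close>: its cardinality takes the role of \<open>k\<close> in the induction.\<close>

definition graph_components :: "'a set \<Rightarrow> 'a set set \<Rightarrow> 'a set set" where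
  "graph_components A C = (\<lambda>a. graph_reach C `` {a}) ` A"

lemma equiv_graph_reach: "equiv UNIV (graph_reach C)"
proof (rule equivI)
  have "sym {(x, y). {x, y} \<in> C}" by (auto simp: sym_def insert_commute)
  then show "sym (graph_reach C)" by (simp add: graph_reach_def sym_rtrancl)
qed (auto simp: graph_reach_def refl_rtrancl trans_rtrancl)

lemma graph_reach_mono: "C \<subseteq> D \<Longrightarrow> graph_reach C \<subseteq> graph_reach D"
  unfolding graph_reach_def by (rule rtrancl_mono) auto

lemma connected_graph_iff: "connected_graph A C \<longleftrightarrow> (\<forall>a\<in>A. \<forall>b\<in>A. (a, b) \<in> graph_reach C)"
  by (simp add: connected_graph_def graph_reach_def)

lemma connected_graph_mono: "connected_graph A C \<Longrightarrow> C \<subseteq> D \<Longrightarrow> connected_graph A D"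
  using graph_reach_mono unfolding connected_graph_iff by blast

lemma graph_class_eq: "graph_reach C `` {x} = graph_reach C `` {y} \<longleftrightarrow> (x, y) \<in> graph_reach C"
  using eq_equiv_class_iff[OF equiv_graph_reach] by simp

text \<open>The new edge contributes only pairs that the reflexive transitive closure already
  contains. This is the case of contracting a loop.\<close>

lemma graph_reach_insert_loop:
  assumes "(a, b) \<in> graph_reach C"
  shows "graph_reach (insert {a, b} C) = graph_reach C"
proof
  have "{(x, y). {x, y} \<in> insert {a, b} C} \<subseteq> graph_reach C"
    using assms equivE[OF equiv_graph_reach[of C]]
    by (auto simp: doubleton_eq_iff graph_reach_def dest: symD)
  then show "graph_reach (insert {a, b} C) \<subseteq> graph_reach C"
    by (metis graph_reach_def rtrancl_idemp rtrancl_mono)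
qed (rule graph_reach_mono, auto)

text \<open>A chain joining points that were not joined before must use the new edge, so each of its
  ends was already joined to \<open>a\<close> or to \<open>b\<close>.\<close>

lemma graph_reach_insertD:
  assumes "(x, y) \<in> graph_reach (insert {a, b} C)" and "(x, y) \<notin> graph_reach C"
  shows "((x, a) \<in> graph_reach C \<or> (x, b) \<in> graph_reach C) \<and>
         ((y, a) \<in> graph_reach C \<or> (y, b) \<in> graph_reach C)"
proof -
  have E: "sym (graph_reach C)" "trans (graph_reach C)" "\<And>x. (x, x) \<in> graph_reach C"
    using equiv_graph_reach[of C] by (auto simp: equiv_def refl_on_def)
  \<comment> \<open>Initial pieces of the chain may avoid the new edge, so the induction needs the
    disjunction.\<close>
  have "(x, y) \<in> graph_reach C \<or> ((x, a) \<in> graph_reach C \<or> (x, b) \<in> graph_reach C) \<and>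
         ((y, a) \<in> graph_reach C \<or> (y, b) \<in> graph_reach C)"
    using assms(1) unfolding graph_reach_def[of "insert _ _"]
  proof (induction rule: rtrancl_induct)
    case base
    then show ?case using E by auto
  next
    case (step y z)
    show ?case
    proof (cases "{y, z} \<in> C")
      case True
      then have yz: "(y, z) \<in> graph_reach C" by (auto simp: graph_reach_def)
      with E have "(z, y) \<in> graph_reach C" by (meson symD)
      with yz step.IH E show ?thesis by (meson transD)
    next
      case False
      then have "y = a \<and> z = b \<or> y = b \<and> z = a" using step.hyps by (auto simp: doubleton_eq_iff)
      then show ?thesis using step.IH E by blast
    qed
  qed
  then show ?thesis using assms(2) by blast
qed

text \<open>Each class of \<open>C\<close> lies in one class of \<open>D\<close>. Taking images
  under \<open>graph_reach D\<close> is therefore the natural map from components of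
  \<open>C\<close> onto components of \<open>D\<close>.\<close>

lemma graph_reach_Image_class:
  assumes "C \<subseteq> D"
  shows "graph_reach D `` (graph_reach C `` {x}) = graph_reach D `` {x}"
proof
  show "graph_reach D `` (graph_reach C `` {x}) \<subseteq> graph_reach D `` {x}"
    using graph_reach_mono[OF assms] equivE[OF equiv_graph_reach[of D]] by (auto dest: transD)
  show "graph_reach D `` {x} \<subseteq> graph_reach D `` (graph_reach C `` {x})"
    by (auto simp: graph_reach_def)
qed

text \<open>The natural map onto the new components identifies the classes of \<open>a\<close> and
  \<open>b\<close>, so it is surjective but not injective.\<close>

lemma graph_components_insert_less:
  assumes "finite A" and "a \<in> A" and "b \<in> A" and "(a, b) \<notin> graph_reach C"
  shows "card (graph_components A (insert {a, b} C)) < card (graph_components A C)"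
proof -
  let ?D = "insert {a, b} C"
  let ?f = "\<lambda>X. graph_reach ?D `` X"
  have f: "graph_reach ?D `` (graph_reach C `` {x}) = graph_reach ?D `` {x}" for x
    by (rule graph_reach_Image_class) auto
  then have im: "graph_components A ?D = ?f ` graph_components A C"
    by (simp add: graph_components_def image_image)
  have fin: "finite (graph_components A C)" using assms(1) by (simp add: graph_components_def)
  have "(a, b) \<in> graph_reach ?D" by (auto simp: graph_reach_def)
  then have "?f (graph_reach C `` {a}) = ?f (graph_reach C `` {b})"
    unfolding f graph_class_eq .
  moreover have "graph_reach C `` {a} \<noteq> graph_reach C `` {b}" using assms(4) by (simp add: graph_class_eq)
  moreover have "graph_reach C `` {a} \<in> graph_components A C" "graph_reach C `` {b} \<in> graph_components A C"
    using assms by (auto simp: graph_components_def)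
  ultimately have "\<not> inj_on ?f (graph_components A C)" by (meson inj_onD)
  then show ?thesis unfolding im using fin
    by (metis card_image_le eq_card_imp_inj_on le_neq_implies_less)
qed

text \<open>Once the class of \<open>a\<close> is set aside, the natural map is injective: points
  newly joined lie in the classes of \<open>a\<close> and \<open>b\<close>, hence here both in that
  of \<open>b\<close>.\<close>

lemma graph_components_le_insert:
  assumes "finite A" and "a \<in> A" and "b \<in> A"
  shows "card (graph_components A C) \<le> Suc (card (graph_components A (insert {a, b} C)))"
proof -
  let ?D = "insert {a, b} C"
  \<comment> \<open>The points of \<open>A\<close> outside the component of
    \<open>a\<close>.\<close>
  let ?B = "{x \<in> A. (x, a) \<notin> graph_reach C}"
  let ?f = "\<lambda>X. graph_reach ?D `` X"
  have f: "graph_reach ?D `` (graph_reach C `` {x}) = graph_reach ?D `` {x}" for x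
    by (rule graph_reach_Image_class) auto
  have E: "sym (graph_reach C)" "trans (graph_reach C)"
    using equiv_graph_reach[of C] by (auto simp: equiv_def)
  have sub: "graph_components A C \<subseteq> insert (graph_reach C `` {a}) (graph_components ?B C)"
  proof
    fix X assume "X \<in> graph_components A C"
    then obtain x where x: "x \<in> A" "X = graph_reach C `` {x}" by (auto simp: graph_components_def)
    show "X \<in> insert (graph_reach C `` {a}) (graph_components ?B C)"
    proof (cases "(x, a) \<in> graph_reach C")
      case True
      then show ?thesis using x graph_class_eq[of C x a] by simp
    next
      case False
      then show ?thesis using x unfolding graph_components_def by blast
    qed
  qed
  have "inj_on ?f (graph_components ?B C)"
  proof (rule inj_onI)
    fix X Y assume "X \<in> graph_components ?B C" "Y \<in> graph_components ?B C" and eq: "?f X = ?f Y"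
    then obtain x y where xy: "x \<in> ?B" "X = graph_reach C `` {x}" "y \<in> ?B" "Y = graph_reach C `` {y}"
      by (auto simp: graph_components_def)
    then have "(x, y) \<in> graph_reach ?D" using eq by (simp add: f graph_class_eq)
    moreover have "(x, y) \<in> graph_reach C" if "(x, b) \<in> graph_reach C" "(y, b) \<in> graph_reach C"
      using that E by (meson symD transD)
    ultimately have "(x, y) \<in> graph_reach C"
      using graph_reach_insertD[of x y a b C] xy by blast
    then show "X = Y" by (simp add: xy graph_class_eq)
  qed
  moreover have "?f ` graph_components ?B C \<subseteq> graph_components A ?D"
    using f by (auto simp: graph_components_def)
  moreover have fin: "finite (graph_components A ?D)" "finite (graph_components ?B C)"
    using assms(1) by (simp_all add: graph_components_def)
  ultimately have "card (graph_components ?B C) \<le> card (graph_components A ?D)"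
    by (intro card_inj_on_le) auto
  moreover have "card (graph_components A C) \<le> card (insert (graph_reach C `` {a}) (graph_components ?B C))"
    using sub fin(2) by (intro card_mono) auto
  moreover have "\<dots> \<le> Suc (card (graph_components ?B C))"
    using fin(2) by (simp add: card_insert_if)
  ultimately show ?thesis by linarith
qed

section \<open>The least number of edges of a connected graph\<close>

lemma graph_components_empty: "card (graph_components A {}) = card A"
  by (simp add: graph_components_def graph_reach_def card_image inj_on_def)

text \<open>Without edges there are \<open>card A\<close> components, and each added edge lowers
  their number by at most one.\<close>

lemma card_le_graph_components_plus_edges:
  assumes "finite A" and "finite F" and "F \<subseteq> {{a, b} | a b. a \<in> A \<and> b \<in> A}"
  shows "card A \<le> card (graph_components A F) + card F"
  using assms(2,3)
proof (induction F rule: finite_induct)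
  case empty
  then show ?case by (simp add: graph_components_empty)
next
  case (insert e F)
  then obtain a b where "e = {a, b}" "a \<in> A" "b \<in> A" by auto
  then show ?case using graph_components_le_insert[OF assms(1), of a b F] insert by auto
qed

text \<open>A face with \<open>card F\<close> edges has dimension \<open>card F - 1\<close>, so no
  connected graph has dimension below \<open>k - 2\<close>.\<close>

lemma card_le_connected_graph:
  assumes "finite A" and "finite F" and "F \<subseteq> {{a, b} | a b. a \<in> A \<and> b \<in> A}" and "connected_graph A F"
  shows "card A \<le> Suc (card F)"
proof -
  have "card (graph_components A F) \<le> 1"
  proof (cases "A = {}")
    case False
    then obtain a where "a \<in> A" by blast
    then have "graph_reach F `` {x} = graph_reach F `` {a}" if "x \<in> A" for x
      using that assms(4) by (simp add: connected_graph_iff graph_class_eq)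
    then have "graph_components A F \<subseteq> {graph_reach F `` {a}}"
      unfolding graph_components_def by blast
    then show ?thesis using card_mono[of "{graph_reach F `` {a}}"] by simp
  qed (simp add: graph_components_def)
  then show ?thesis using card_le_graph_components_plus_edges[OF assms(1-3)] by simp
qed

section \<open>Exactness by deletion and contraction\<close>

text \<open>
  To avoid multigraphs, contracted edges are not removed but collected in the set \<open>C\<close>: a face \<open>F\<close> of the
  contracted graph counts as connected if \<open>F \<union> C\<close> is connected.
\<close>

lemma connected_chain_exact:
  assumes U: "linear_order_on U r" and A: "finite A" "A \<noteq> {}"
    and UA: "U \<subseteq> {{a, b} | a b. a \<in> A \<and> b \<in> A}"
    and "finite E" and "E \<subseteq> U"
    and "Poly_Mapping.keys c \<subseteq> {F. F \<subseteq> E \<and> card F = m}"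
    and "Poly_Mapping.keys (simplex_boundary r c) \<subseteq> {F. \<not> connected_graph A (F \<union> C)}"
    and "card (graph_components A C) \<le> m"
  shows "\<exists>c'. Poly_Mapping.keys c' \<subseteq> {F. F \<subseteq> E \<and> card F = Suc m} \<and>
    Poly_Mapping.keys (c - simplex_boundary r c') \<subseteq> {F. \<not> connected_graph A (F \<union> C)}"
  using assms(5-)
\<comment> \<open>\<open>C\<close> and \<open>m\<close> vary because contraction enlarges
  \<open>C\<close> and lowers \<open>m\<close>. The contracted graph has
  \<open>card (graph_components A C)\<close> vertices, so the bound by \<open>m\<close> says that
  the dimension \<open>m - 1\<close> lies above the critical one.\<close>
proof (induction "card E" arbitrary: E C c m)
  case 0
  then have "E = {}" by simp
  \<comment> \<open>The only face is the empty one, of size \<open>0\<close>, whereas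
    \<open>m\<close> is at least the positive number of components; so the chain vanishes.\<close>
  have "card (graph_components A C) \<noteq> 0" using A by (simp add: graph_components_def)
  then have "{F. F \<subseteq> E \<and> card F = m} = {}" using 0 \<open>E = {}\<close> by auto
  then have "c = 0" using "0.prems"(3) by (metis keys_eq_empty subset_empty)
  then show ?case by (intro exI[of _ 0]) simp
next
  case (Suc n)
  from Suc.hyps(2) Suc.prems(1,2) obtain e where e: "e \<in> E" "\<And>u. u \<in> E \<Longrightarrow> (e, u) \<in> r"
    using linear_order_on_finite_least[OF U, of E] by (metis card.empty nat.distinct(1))
  obtain v w where vw: "e = {v, w}" "v \<in> A" "w \<in> A" using e(1) Suc.prems(2) UA by blast
  have anti: "antisym r" using U by (simp add: order_on_defs)
  let ?N = "\<lambda>C. {F. \<not> connected_graph A (F \<union> C)}"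
  define E' where "E' = E - {e}"
  have E': "finite E'" "E' \<subseteq> U" "n = card E'" "e \<notin> E'" "E' \<subseteq> E"
    using Suc.prems Suc.hyps(2) e(1) by (auto simp: E'_def)
  have below: "G \<subseteq> E' \<Longrightarrow> finite G \<and> e \<notin> G \<and> (\<forall>u\<in>G. (e, u) \<in> r)" for G
    using E' e finite_subset[of G E'] by blast
  define a where "a = deletion_part e c"
  define b where "b = link_part e c"
  have c: "c = a + cone e b" by (simp add: a_def b_def deletion_plus_cone_link)
  have a: "Poly_Mapping.keys a \<subseteq> {F. F \<subseteq> E' \<and> card F = m}"
    using keys_deletion_part[of e c] Suc.prems(3) by (auto simp: a_def E'_def)
  have "card (F - {e}) = card F - 1" if "e \<in> F" for F
    using that by simp
  then have b: "Poly_Mapping.keys b \<subseteq> {F. F \<subseteq> E' \<and> card F = m - 1}"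
    using keys_link_part[of e c] Suc.prems(3) by (fastforce simp: b_def E'_def)
  have bdry_cone: "simplex_boundary r (cone e z) = z - cone e (simplex_boundary r z)"
    if "Poly_Mapping.keys z \<subseteq> {F. F \<subseteq> E' \<and> card F = k}" for z k
    using that below by (intro simplex_boundary_cone anti) blast
  have bdry_e: "Poly_Mapping.keys (simplex_boundary r z) \<subseteq> {F. e \<notin> F}"
    if "Poly_Mapping.keys z \<subseteq> {F. F \<subseteq> E' \<and> card F = k}" for z k
    using keys_simplex_boundary[of r z] that E'(4) by blast
  have e_notin: "Poly_Mapping.keys z \<subseteq> {F. e \<notin> F}"
    if "Poly_Mapping.keys z \<subseteq> {F. F \<subseteq> E' \<and> card F = k}" for z :: "'a set set \<Rightarrow>\<^sub>0 int" and k
    using that E'(4) by blast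
  \<comment> \<open>The first two summands are free of \<open>e\<close> and the last is a cone from
    \<open>e\<close>, so the two parts of the boundary can be read off separately.\<close>
  let ?d = "simplex_boundary r a + b - cone e (simplex_boundary r b)"
  have dc: "simplex_boundary r c = ?d"
    by (simp add: c simplex_boundary_add bdry_cone[OF b])
  have keys_ab: "Poly_Mapping.keys (simplex_boundary r a + b) \<subseteq> {F. e \<notin> F}"
    by (intro keys_subset_add bdry_e[OF a] e_notin[OF b])
  have "deletion_part e ?d = simplex_boundary r a + b"
    by (simp add: deletion_part_diff deletion_part_id[OF keys_ab])
  then have ab: "Poly_Mapping.keys (simplex_boundary r a + b) \<subseteq> ?N C"
    using keys_deletion_part[of e ?d] Suc.prems(4) unfolding dc by auto
  have "link_part e ?d = - simplex_boundary r b"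
    by (simp add: link_part_diff link_part_eq_0[OF keys_ab] link_part_cone[OF bdry_e[OF b]])
  then have "Poly_Mapping.keys (simplex_boundary r b) \<subseteq>
      {F - {e} | F. F \<in> Poly_Mapping.keys ?d \<and> e \<in> F}"
    using keys_link_part[of e ?d] by simp
  also have "\<dots> \<subseteq> ?N (insert e C)"
  proof clarify
    fix F assume F: "F \<in> Poly_Mapping.keys ?d" "e \<in> F"
      and con: "connected_graph A (F - {e} \<union> insert e C)"
    \<comment> \<open>Moving \<open>e\<close> from the face into the contracted set leaves the
      tested graph unchanged.\<close>
    have "F - {e} \<union> insert e C = F \<union> C" using F by blast
    then show False using F con Suc.prems(4) unfolding dc by auto
  qed
  finally have db: "Poly_Mapping.keys (simplex_boundary r b) \<subseteq> ?N (insert e C)" .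
  \<comment> \<open>A face that is not connected even with \<open>e\<close> contracted is not
    connected without it.\<close>
  have N_mono: "?N (insert e C) \<subseteq> ?N C"
  proof -
    have "connected_graph A (F \<union> insert e C)" if "connected_graph A (F \<union> C)" for F
      by (rule connected_graph_mono[OF that]) blast
    then show ?thesis by blast
  qed
  have cone_N: "Poly_Mapping.keys (cone e z) \<subseteq> ?N C" if "Poly_Mapping.keys z \<subseteq> ?N (insert e C)" for z
  proof
    fix G assume "G \<in> Poly_Mapping.keys (cone e z)"
    then obtain F where "G = insert e F" "F \<in> Poly_Mapping.keys z" using keys_cone[of e z] by blast
    then show "G \<in> ?N C" using that by auto
  qed
  have cone_E: "Poly_Mapping.keys (cone e z) \<subseteq> {F. F \<subseteq> E \<and> card F = Suc k}"
    if "Poly_Mapping.keys z \<subseteq> {F. F \<subseteq> E' \<and> card F = k}" for z k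
  proof
    fix G assume "G \<in> Poly_Mapping.keys (cone e z)"
    then obtain F where F: "G = insert e F" "F \<in> Poly_Mapping.keys z" using keys_cone[of e z] by blast
    then have "F \<subseteq> E'" "card F = k" using that by auto
    then show "G \<in> {F. F \<subseteq> E \<and> card F = Suc k}" using F(1) below[of F] E'(5) e(1) by auto
  qed
  show ?case
  proof (cases "(v, w) \<in> graph_reach C")
    case True
    \<comment> \<open>A loop never affects connectedness, so contracting \<open>e\<close> leaves the
      family of nonconnected faces unchanged.\<close>
    have "graph_reach (insert e (F \<union> C)) = graph_reach (F \<union> C)" for F
      using graph_reach_insert_loop[of v w "F \<union> C"] graph_reach_mono[of C "F \<union> C"] True vw(1) by blast
    then have N: "?N (insert e C) = ?N C" by (simp add: connected_graph_iff)
    \<comment> \<open>Here \<open>\<partial>(e a) = a - e \<partial>a\<close>, so the difference is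
      the cone over \<open>\<partial>a + b\<close>, whose faces are nonconnected.\<close>
    have "c - simplex_boundary r (cone e a) = cone e (simplex_boundary r a + b)"
      by (simp add: bdry_cone[OF a] cone_add) (simp add: c)
    then have "Poly_Mapping.keys (c - simplex_boundary r (cone e a)) \<subseteq> ?N C"
      using cone_N ab N by simp
    with cone_E[OF a] show ?thesis by blast
  next
    case False
    then have less: "card (graph_components A (insert e C)) < card (graph_components A C)"
      using graph_components_insert_less[OF A(1) vw(2,3)] vw(1) by simp
    \<comment> \<open>Contraction loses a vertex just as \<open>b\<close> loses an edge, so the
      bound survives for \<open>b\<close>. The strict drop also forces \<open>m > 0\<close>, so the
      truncated subtraction is harmless.\<close>
    then have m: "card (graph_components A (insert e C)) \<le> m - 1" "Suc (m - 1) = m"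
      using Suc.prems(5) by auto
    obtain b' where b': "Poly_Mapping.keys b' \<subseteq> {F. F \<subseteq> E' \<and> card F = m}"
      "Poly_Mapping.keys (b - simplex_boundary r b') \<subseteq> ?N (insert e C)"
      using Suc.hyps(1)[OF E'(3,1,2) b db m(1)] m(2) by auto
    \<comment> \<open>Replacing \<open>e b\<close> by \<open>b'\<close> keeps a relative cycle, now
      with faces in \<open>E'\<close>; hence the second use of the induction hypothesis, with
      \<open>C\<close> and \<open>m\<close> unchanged.\<close>
    have "simplex_boundary r (a + b') = (simplex_boundary r a + b) - (b - simplex_boundary r b')"
      by (simp add: simplex_boundary_add)
    then have dab: "Poly_Mapping.keys (simplex_boundary r (a + b')) \<subseteq> ?N C"
      using keys_subset_diff[OF ab order_trans[OF b'(2) N_mono]] by simp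
    obtain a' where a': "Poly_Mapping.keys a' \<subseteq> {F. F \<subseteq> E' \<and> card F = Suc m}"
      "Poly_Mapping.keys (a + b' - simplex_boundary r a') \<subseteq> ?N C"
      using Suc.hyps(1)[OF E'(3,1,2) keys_subset_add[OF a b'(1)] dab Suc.prems(5)] by blast
    \<comment> \<open>Since \<open>\<partial>(e b') = b' - e \<partial>b'\<close>, subtracting
      \<open>e b'\<close> from \<open>a'\<close> trades \<open>e b\<close> for \<open>b'\<close> up
      to the cone over \<open>b - \<partial>b'\<close>.\<close>
    have "c - simplex_boundary r (a' - cone e b') =
        (a + b' - simplex_boundary r a') + cone e (b - simplex_boundary r b')"
      by (simp add: simplex_boundary_diff bdry_cone[OF b'(1)] cone_diff) (simp add: c)
    then have "Poly_Mapping.keys (c - simplex_boundary r (a' - cone e b')) \<subseteq> ?N C"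
      using keys_subset_add[OF a'(2) cone_N[OF b'(2)]] by simp
    moreover have "Poly_Mapping.keys a' \<subseteq> {F. F \<subseteq> E \<and> card F = Suc m}" using a'(1) E'(5) by blast
    then have "Poly_Mapping.keys (a' - cone e b') \<subseteq> {F. F \<subseteq> E \<and> card F = Suc m}"
      by (rule keys_subset_diff) (rule cone_E[OF b'(1)])
    ultimately show ?thesis by blast
  qed
qed

section \<open>Homology of the quotient complex\<close>

abbreviation simplices :: "'e set set \<Rightarrow> int \<Rightarrow> 'e set set" where
  "simplices K i \<equiv> {F \<in> K. finite F \<and> int (card F) - 1 = i}"

text \<open>The form that homology takes once cycles and boundaries coincide.\<close>

lemma (in group) trivial_Mod_carrier: "trivial_group (G Mod carrier G)"
proof -
  have n: "carrier G \<lhd> G"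
    by (rule normal_invI) (auto intro: subgroup_self)
  have "rcosets (carrier G) = {carrier G}"
    by (auto simp: RCOSETS_def subgroup_self coset_join2)
  then show ?thesis
    using normal.factorgroup_is_group[OF n] by (simp add: trivial_group_def FactGroup_def)
qed

lemma simplex_boundary_closed:
  assumes "\<forall>F\<in>K. Pow F \<subseteq> K" and "Poly_Mapping.keys c \<subseteq> simplices K i"
  shows "Poly_Mapping.keys (simplex_boundary r c) \<subseteq> simplices K (i - 1)"
proof -
  have "F - {v} \<in> simplices K (i - 1)" if "F \<in> simplices K i" "v \<in> F" for F v
  proof -
    have "card F = Suc (card (F - {v}))" using that card_Suc_Diff1[of F v] by simp
    then show ?thesis using that assms(1) by auto
  qed
  then show ?thesis using keys_simplex_boundary[of r c] assms(2) by blast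
qed

lemma simplex_subgroup_normal:
  assumes "L \<subseteq> K"
  shows "carrier (simplex_chain_group L i) \<lhd> simplex_chain_group K i"
proof -
  interpret comm_group "simplex_chain_group K i"
    by (simp add: simplex_chain_group_def abelian_free_Abelian_group)
  have "subgroup (carrier (simplex_chain_group L i)) (simplex_chain_group K i)"
  proof (rule subgroupI)
    show "carrier (simplex_chain_group L i) \<subseteq> carrier (simplex_chain_group K i)"
      using assms by (fastforce simp: simplex_chain_group_def)
    have "0 \<in> carrier (simplex_chain_group L i)" by (simp add: simplex_chain_group_def)
    then show "carrier (simplex_chain_group L i) \<noteq> {}" by blast
  next
    fix a b assume ab: "a \<in> carrier (simplex_chain_group L i)" "b \<in> carrier (simplex_chain_group L i)"
    show "a \<otimes>\<^bsub>simplex_chain_group K i\<^esub> b \<in> carrier (simplex_chain_group L i)"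
      using ab by (simp add: simplex_chain_group_def keys_subset_add)
  next
    fix a assume a: "a \<in> carrier (simplex_chain_group L i)"
    then have "Poly_Mapping.keys a \<subseteq> simplices K i"
      using assms by (fastforce simp: simplex_chain_group_def)
    then show "inv\<^bsub>simplex_chain_group K i\<^esub> a \<in> carrier (simplex_chain_group L i)"
      using a by (simp add: simplex_chain_group_def)
  qed
  then show ?thesis by (rule subgroup_imp_normal)
qed

lemma group_quotient_chain_group: "L \<subseteq> K \<Longrightarrow> group (quotient_chain_group K L i)"
  unfolding quotient_chain_group_def by (intro normal.factorgroup_is_group simplex_subgroup_normal)

lemma carrier_quotient_chain_group:
  "carrier (quotient_chain_group K L i) =
    (\<lambda>c. carrier (simplex_chain_group L i) #>\<^bsub>simplex_chain_group K i\<^esub> c) ` {c. Poly_Mapping.keys c \<subseteq> simplices K i}"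
  by (auto simp: quotient_chain_group_def FactGroup_def RCOSETS_def simplex_chain_group_def)

text \<open>Turns equality in the quotient into a condition on supports, so that exactness can be
  treated with chains alone.\<close>

lemma coset_eq_iff:
  assumes "L \<subseteq> K" and "Poly_Mapping.keys a \<subseteq> simplices K i" and "Poly_Mapping.keys b \<subseteq> simplices K i"
  shows "carrier (simplex_chain_group L i) #>\<^bsub>simplex_chain_group K i\<^esub> a =
      carrier (simplex_chain_group L i) #>\<^bsub>simplex_chain_group K i\<^esub> b
    \<longleftrightarrow> Poly_Mapping.keys (a - b) \<subseteq> simplices L i"
proof -
  interpret normal "carrier (simplex_chain_group L i)" "simplex_chain_group K i"
    by (rule simplex_subgroup_normal[OF assms(1)])
  have ab: "a \<in> carrier (simplex_chain_group K i)" "b \<in> carrier (simplex_chain_group K i)"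
    using assms by (simp_all add: simplex_chain_group_def)
  have "carrier (simplex_chain_group L i) #>\<^bsub>simplex_chain_group K i\<^esub> a =
      carrier (simplex_chain_group L i) #>\<^bsub>simplex_chain_group K i\<^esub> b
    \<longleftrightarrow> a \<in> carrier (simplex_chain_group L i) #>\<^bsub>simplex_chain_group K i\<^esub> b"
    using repr_independence[OF _ ab(2) subgroup_axioms] rcos_self[OF ab(1) subgroup_axioms] by metis
  also have "\<dots> \<longleftrightarrow> a - b \<in> carrier (simplex_chain_group L i)"
    using rcos_module[OF is_group ab(2,1)] assms by (simp add: simplex_chain_group_def)
  finally show ?thesis by (simp add: simplex_chain_group_def)
qed

text \<open>Representatives differ by a chain of \<open>L\<close>, whose boundary stays in
  \<open>L\<close> because \<open>L\<close> is closed under subsets. The image under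
  \<open>the_elem\<close> is thus a singleton.\<close>

lemma quotient_boundary_coset:
  assumes "L \<subseteq> K" and K: "\<forall>F\<in>K. Pow F \<subseteq> K"
    and L: "\<forall>F\<in>L. Pow F \<subseteq> L"
    and c: "Poly_Mapping.keys c \<subseteq> simplices K i"
  shows "quotient_boundary r K L i (carrier (simplex_chain_group L i) #>\<^bsub>simplex_chain_group K i\<^esub> c) =
    carrier (simplex_chain_group L (i - 1)) #>\<^bsub>simplex_chain_group K (i - 1)\<^esub> simplex_boundary r c"
proof -
  let ?q = "\<lambda>c. carrier (simplex_chain_group L (i - 1)) #>\<^bsub>simplex_chain_group K (i - 1)\<^esub> simplex_boundary r c"
  let ?L = "{l::'a set \<Rightarrow>\<^sub>0 int. Poly_Mapping.keys l \<subseteq> simplices L i}"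
  have X: "carrier (simplex_chain_group L i) #>\<^bsub>simplex_chain_group K i\<^esub> c = (\<lambda>l. l + c) ` ?L"
    by (auto simp: r_coset_def simplex_chain_group_def)
  have const: "?q (l + c) = ?q c" if "l \<in> ?L" for l
  proof -
    have l: "Poly_Mapping.keys l \<subseteq> simplices L i" using that by simp
    then have "Poly_Mapping.keys l \<subseteq> simplices K i" using assms(1) by blast
    then have "Poly_Mapping.keys (simplex_boundary r (l + c)) \<subseteq> simplices K (i - 1)"
      by (intro simplex_boundary_closed[OF K] keys_subset_add c)
    moreover have "simplex_boundary r (l + c) - simplex_boundary r c = simplex_boundary r l"
      by (simp add: simplex_boundary_add)
    ultimately show ?thesis
      using coset_eq_iff[OF assms(1) _ simplex_boundary_closed[OF K c], of "simplex_boundary r (l + c)"]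
        simplex_boundary_closed[OF L l, of r] by simp
  qed
  have "?q ` (\<lambda>l. l + c) ` ?L = (\<lambda>l. ?q c) ` ?L"
    unfolding image_image by (rule image_cong[OF refl]) (rule const)
  also have "\<dots> = {?q c}"
  proof -
    have "0 \<in> ?L" by simp
    then show ?thesis unfolding image_constant_conv by (metis empty_iff)
  qed
  finally show ?thesis unfolding quotient_boundary_def X by (simp only: the_elem_eq)
qed

lemma quotient_boundary_hom:
  assumes "L \<subseteq> K" and K: "\<forall>F\<in>K. Pow F \<subseteq> K"
    and L: "\<forall>F\<in>L. Pow F \<subseteq> L"
  shows "quotient_boundary r K L i \<in> hom (quotient_chain_group K L i) (quotient_chain_group K L (i - 1))"
proof (rule homI)
  fix X assume "X \<in> carrier (quotient_chain_group K L i)"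
  then obtain a where a: "Poly_Mapping.keys a \<subseteq> simplices K i"
    "X = carrier (simplex_chain_group L i) #>\<^bsub>simplex_chain_group K i\<^esub> a"
    unfolding carrier_quotient_chain_group by auto
  show "quotient_boundary r K L i X \<in> carrier (quotient_chain_group K L (i - 1))"
    using simplex_boundary_closed[OF K a(1)]
    unfolding a(2) quotient_boundary_coset[OF assms a(1)] carrier_quotient_chain_group by blast
next
  fix X Y assume "X \<in> carrier (quotient_chain_group K L i)" "Y \<in> carrier (quotient_chain_group K L i)"
  then obtain a b where ab: "Poly_Mapping.keys a \<subseteq> simplices K i" "Poly_Mapping.keys b \<subseteq> simplices K i"
    "X = carrier (simplex_chain_group L i) #>\<^bsub>simplex_chain_group K i\<^esub> a"
    "Y = carrier (simplex_chain_group L i) #>\<^bsub>simplex_chain_group K i\<^esub> b"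
    unfolding carrier_quotient_chain_group by auto
  have mult: "(carrier (simplex_chain_group L j) #>\<^bsub>simplex_chain_group K j\<^esub> u) \<otimes>\<^bsub>quotient_chain_group K L j\<^esub>
      (carrier (simplex_chain_group L j) #>\<^bsub>simplex_chain_group K j\<^esub> v) =
      carrier (simplex_chain_group L j) #>\<^bsub>simplex_chain_group K j\<^esub> (u + v)"
    if "Poly_Mapping.keys u \<subseteq> simplices K j" "Poly_Mapping.keys v \<subseteq> simplices K j" for u v j
    using normal.rcos_sum[OF simplex_subgroup_normal[OF assms(1)], of u j v] that
    by (simp add: quotient_chain_group_def FactGroup_def simplex_chain_group_def)
  show "quotient_boundary r K L i (X \<otimes>\<^bsub>quotient_chain_group K L i\<^esub> Y) =
      quotient_boundary r K L i X \<otimes>\<^bsub>quotient_chain_group K L (i - 1)\<^esub> quotient_boundary r K L i Y"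
    using simplex_boundary_closed[OF K ab(1)] simplex_boundary_closed[OF K ab(2)]
    by (simp add: ab(3,4) mult ab(1,2) quotient_boundary_coset[OF assms] keys_subset_add simplex_boundary_add)
qed

text \<open>The assumption \<open>exact\<close> lifts every relative cycle to a boundary modulo
  \<open>L\<close>, so cycles lie among boundaries; the converse inclusion is
  \<open>\<partial>\<partial> = 0\<close>.\<close>

lemma trivial_quotient_homology_group:
  assumes LK: "L \<subseteq> K" and K: "\<forall>F\<in>K. Pow F \<subseteq> K"
    and L: "\<forall>F\<in>L. Pow F \<subseteq> L"
    and r: "linear_order_on U r" "K \<subseteq> Pow U"
    and exact: "\<And>c. Poly_Mapping.keys c \<subseteq> simplices K i \<Longrightarrow>
      Poly_Mapping.keys (simplex_boundary r c) \<subseteq> simplices L (i - 1) \<Longrightarrow>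
      \<exists>c'. Poly_Mapping.keys c' \<subseteq> simplices K (i + 1) \<and>
        Poly_Mapping.keys (c - simplex_boundary r c') \<subseteq> simplices L i"
  shows "trivial_group (quotient_homology_group r K L i)"
proof -
  let ?Q = "quotient_chain_group K L"
  let ?q = "\<lambda>i c. carrier (simplex_chain_group L i) #>\<^bsub>simplex_chain_group K i\<^esub> c"
  let ?Z = "kernel (?Q i) (?Q (i - 1)) (quotient_boundary r K L i)"
  let ?B = "quotient_boundary r K L (i + 1) ` carrier (?Q (i + 1))"
  interpret group_hom "?Q i" "?Q (i - 1)" "quotient_boundary r K L i"
    using group_quotient_chain_group[OF LK] quotient_boundary_hom[OF LK K L]
    by (simp add: group_hom_def group_hom_axioms_def)
  have one: "\<one>\<^bsub>?Q (i - 1)\<^esub> = ?q (i - 1) 0"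
    using group.coset_mult_one[of "simplex_chain_group K (i - 1)" "carrier (simplex_chain_group L (i - 1))"]
      normal_imp_subgroup[OF simplex_subgroup_normal[OF LK], THEN subgroup.subset, of "i - 1"]
    by (simp add: quotient_chain_group_def FactGroup_def simplex_chain_group_def)
  have Z: "?Z = ?q i ` {c. Poly_Mapping.keys c \<subseteq> simplices K i \<and>
      Poly_Mapping.keys (simplex_boundary r c) \<subseteq> simplices L (i - 1)}"
  proof -
    have "quotient_boundary r K L i (?q i c) = \<one>\<^bsub>?Q (i - 1)\<^esub> \<longleftrightarrow>
        Poly_Mapping.keys (simplex_boundary r c) \<subseteq> simplices L (i - 1)"
      if c: "Poly_Mapping.keys c \<subseteq> simplices K i" for c
      using coset_eq_iff[OF LK simplex_boundary_closed[OF K c], where b = 0]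
      unfolding one quotient_boundary_coset[OF LK K L c] by simp
    then show ?thesis unfolding kernel_def carrier_quotient_chain_group by blast
  qed
  have B: "?B = ?q i ` simplex_boundary r ` {c. Poly_Mapping.keys c \<subseteq> simplices K (i + 1)}"
    using quotient_boundary_coset[OF LK K L, of _ "i + 1"]
    unfolding carrier_quotient_chain_group image_image by (intro image_cong) auto
  have bdry: "Poly_Mapping.keys (simplex_boundary r c) \<subseteq> simplices K i"
    if "Poly_Mapping.keys c \<subseteq> simplices K (i + 1)" for c
    using simplex_boundary_closed[OF K that] by simp
  have "?B = ?Z"
  proof
    have bb: "simplex_boundary r (simplex_boundary r c) = 0"
      if "Poly_Mapping.keys c \<subseteq> simplices K (i + 1)" for c
    proof (rule simplex_boundary_boundary[OF r(1)])
      have "simplices K (i + 1) \<subseteq> {F. finite F \<and> F \<subseteq> U}" using r(2) by auto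
      then show "Poly_Mapping.keys c \<subseteq> {F. finite F \<and> F \<subseteq> U}" using that by (rule order_trans[rotated])
    qed
    show "?B \<subseteq> ?Z"
      unfolding B Z by (intro image_mono image_subsetI CollectI conjI; drule CollectD) (simp_all only: bb bdry keys_zero empty_subsetI)
    show "?Z \<subseteq> ?B"
    proof
      fix X assume "X \<in> ?Z"
      then obtain c where c: "X = ?q i c" "Poly_Mapping.keys c \<subseteq> simplices K i"
        "Poly_Mapping.keys (simplex_boundary r c) \<subseteq> simplices L (i - 1)"
        unfolding Z by blast
      obtain c' where c': "Poly_Mapping.keys c' \<subseteq> simplices K (i + 1)"
        "Poly_Mapping.keys (c - simplex_boundary r c') \<subseteq> simplices L i"
        using exact[OF c(2,3)] by blast
      then have "X = ?q i (simplex_boundary r c')"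
        unfolding c(1) using coset_eq_iff[OF LK c(2) bdry[OF c'(1)]] by simp
      then show "X \<in> ?B" unfolding B using c'(1) by (intro image_eqI[OF _ imageI] CollectI)
    qed
  qed
  moreover have "carrier (subgroup_generated (?Q i) ?Z) = ?Z"
    by (rule subgroup.carrier_subgroup_generated_subgroup[OF subgroup_kernel])
  ultimately show ?thesis
    unfolding quotient_homology_group_def
    using group.trivial_Mod_carrier[OF G.group_subgroup_generated, of ?Z] by simp
qed

section \<open>Acyclicity of the complex of connected concordant graphs\<close>

theorem theorem5:
  fixes A :: "'a set" and P :: "nat \<Rightarrow> 'a set" and k d :: nat
    and r :: "'a set rel" and i :: int
  assumes "finite A" and "card A = k" and "d \<ge> 1"
    and "A = (\<Union>j\<in>{1..d}. P j)"
    and "disjoint_family_on P {1..d}"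
    and "\<And>j. j \<in> {1..d} \<Longrightarrow> P j \<noteq> {}"
    and "linear_order_on (concordant_edges d P) r"
    and "i \<noteq> int k - 2"
  shows "trivial_group (connected_graph_homology r A d P i)"
  unfolding connected_graph_homology_def
proof (rule trivial_quotient_homology_group[OF _ _ _ assms(7)])
  let ?E = "concordant_edges d P"
  let ?K = "concordant_simplex d P"
  let ?L = "nonconnected_subcomplex A d P"
  show "?L \<subseteq> ?K" "?K \<subseteq> Pow ?E"
    by (auto simp: nonconnected_subcomplex_def concordant_simplex_def)
  show K_closed: "\<forall>F\<in>?K. Pow F \<subseteq> ?K"
    by (auto simp: concordant_simplex_def)
  \<comment> \<open>Deleting edges cannot make a graph connected.\<close>
  then show "\<forall>F\<in>?L. Pow F \<subseteq> ?L"
    using connected_graph_mono[of A] unfolding nonconnected_subcomplex_def by blast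
  have EA: "?E \<subseteq> {{a, b} | a b. a \<in> A \<and> b \<in> A}"
    unfolding concordant_edges_def assms(4) by blast
  moreover have "{{a, b} | a b. a \<in> A \<and> b \<in> A} \<subseteq> Pow A" by blast
  ultimately have finE: "finite ?E" using assms(1) by (meson finite_Pow_iff finite_subset)
  \<comment> \<open>For empty \<open>A\<close> the empty face would count as connected and give
    homology in dimension \<open>-1\<close>; the nonempty first part excludes this.\<close>
  have "1 \<in> {1..d}" using assms(3) by simp
  then have "A \<noteq> {}" unfolding assms(4) using assms(6) by blast
  fix c assume c: "Poly_Mapping.keys c \<subseteq> simplices ?K i"
    and dc: "Poly_Mapping.keys (simplex_boundary r c) \<subseteq> simplices ?L (i - 1)"
  show "\<exists>c'. Poly_Mapping.keys c' \<subseteq> simplices ?K (i + 1) \<and>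
      Poly_Mapping.keys (c - simplex_boundary r c') \<subseteq> simplices ?L i"
  proof (cases "i < int k - 2")
    case True
    \<comment> \<open>Below the critical dimension every chain is zero in the quotient, and
      \<open>0\<close> serves as the bounding chain.\<close>
    have "\<not> connected_graph A F" if "F \<in> simplices ?K i" for F
    proof
      assume "connected_graph A F"
      moreover have "F \<subseteq> {{a, b} | a b. a \<in> A \<and> b \<in> A}"
        using that EA by (auto simp: concordant_simplex_def)
      ultimately have "card A \<le> Suc (card F)"
        using card_le_connected_graph[OF assms(1), of F] that by blast
      with True that assms(2) show False by auto
    qed
    then have "Poly_Mapping.keys c \<subseteq> simplices ?L i"
      using c by (auto simp: nonconnected_subcomplex_def)
    then show ?thesis by (intro exI[of _ 0]) simp
  next
    case False
    \<comment> \<open>The number of edges of a face of dimension \<open>i\<close>. Here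
      \<open>i \<ge> k - 1\<close>, so \<open>m \<ge> k\<close>, the number of components when
      nothing is contracted.\<close>
    define m where "m = nat (i + 1)"
    have m: "int m = i + 1" "k \<le> m" using False assms(8) by (auto simp: m_def)
    have "simplices ?K i = {F. F \<subseteq> ?E \<and> card F = m}" "simplices ?K (i + 1) = {F. F \<subseteq> ?E \<and> card F = Suc m}"
      using m(1) finite_subset[OF _ finE] by (auto simp: concordant_simplex_def)
    note K = this
    have "Poly_Mapping.keys (simplex_boundary r c) \<subseteq> {F. \<not> connected_graph A (F \<union> {})}"
      using dc by (auto simp: nonconnected_subcomplex_def)
    moreover have "card (graph_components A {}) \<le> m" using m(2) assms(2) by (simp add: graph_components_empty)
    ultimately obtain c' where c': "Poly_Mapping.keys c' \<subseteq> {F. F \<subseteq> ?E \<and> card F = Suc m}"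
      "Poly_Mapping.keys (c - simplex_boundary r c') \<subseteq> {F. \<not> connected_graph A (F \<union> {})}"
      using connected_chain_exact[OF assms(7,1) \<open>A \<noteq> {}\<close> EA finE order_refl, of c m "{}"] c
      unfolding K by blast
    \<comment> \<open>The exactness lemma yields only nonconnectedness; membership in the simplex
      and the right dimension are added here.\<close>
    have "Poly_Mapping.keys (simplex_boundary r c') \<subseteq> simplices ?K (i + 1 - 1)"
      using c'(1) unfolding K(2)[symmetric] by (rule simplex_boundary_closed[OF K_closed])
    then have "Poly_Mapping.keys (c - simplex_boundary r c') \<subseteq> simplices ?K i"
      using keys_subset_diff[OF c] by simp
    then have "Poly_Mapping.keys (c - simplex_boundary r c') \<subseteq> simplices ?L i"
      using c'(2) by (auto simp: nonconnected_subcomplex_def)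
    then show ?thesis using c'(1) unfolding K by blast
  qed
qed

end
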